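(* Consider the maximum-likelihood objective for training the implicit negative policy $\pi^-_\theta$: $$\max_\theta\ \mathbb{E}_{p(q)\,\pi^-(a|q)}\left[\log \pi^-_\theta(a|q)\right]\ \Leftrightarrow\ \min_\theta\ \left[-\,\mathbb{E}_{(q,a)\sim \mathcal{D}^-} \log \frac{\pi_{\mathrm{old}}(a|q) - r_q\, \pi^+_\theta(a|q)}{1 - r_q}\right].$$ Assume unlimited data and model capacity, and $0<r_q<1$ for the training questions $q$. Then the optimal solution $\theta^*$ of this problem satisfies $$\forall q, a:\quad \pi^+_{\theta^*}(a|q) = \pi^+(a|q).$$
   Context: Questions $q$ come from a given question set, with distribution $p(q)$; $A$ denotes the space of all possible answers $a$ (the whole language space). A policy $\pi(\cdot|q)$ is a conditional probability distribution over answers given a question. $\pi_{\mathrm{old}}$ is a fixed policy (the pretrained language model that generates the data). A verifier assigns a binary correctness label $r\in\{0,1\}$ to each answer, and $p(r{=}1|q,a)$ is the probability that answer $a$ to $q$ is correct. The correctness rate of $\pi_{\mathrm{old}}$ on $q$ is $$r_q := \sum_{a\in A}\pi_{\mathrm{old}}(a|q)\,p(r{=}1|q,a)=p(r{=}1|q).$$ The positive and negative policies are $$\pi^+(a|q) := \frac{\pi_{\mathrm{old}}(a|q)\,p(r{=}1|q,a)}{\sum_{a'\in A}\pi_{\mathrm{old}}(a'|q)\,p(r{=}1|q,a')},\qquad \pi^-(a|q) := \frac{\pi_{\mathrm{old}}(a|q)\,[1-p(r{=}1|q,a)]}{\sum_{a'\in A}\pi_{\mathrm{old}}(a'|q)\,[1-p(r{=}1|q,a')]}.$$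 The dataset $\mathcal{D}$ consists of questions together with answers sampled from $\pi_{\mathrm{old}}(\cdot|q)$ and their correctness labels; $\mathcal{D}^-$ is the subset of negative answers ($r=0$), so that its answers are distributed according to $\pi^-(\cdot|q)$. $\pi^+_\theta$ is the trained model policy with parameters $\theta$, and the implicit negative policy is its re-parameterization $$\pi^-_\theta(a|q) := \frac{\pi_{\mathrm{old}}(a|q) - r_q\,\pi^+_\theta(a|q)}{1-r_q}.$$
   Formalization: The optimization ranges only over θ for which the implicit negative policy is a genuine probability distribution on the training questions, and the expected log-likelihood is assumed finite for at least one such θ; without these the claim can fail. *)

theory Defs
  imports "HOL-Probability.Probability"
begin

text \<open>
  A policy is a function \<open>'q \<Rightarrow> 'a pmf\<close>. Throughout, \<open>p\<close> is the distribution of the questions (the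
  training questions are the elements of \<open>set_pmf p\<close>), \<open>old\<close> is the data-generating policy, and
  \<open>ver q a\<close> is the distribution of the label of the answer \<open>a\<close> to \<open>q\<close>, where \<open>True\<close> stands for
  \<open>r = 1\<close>. A model is a family \<open>model \<theta>\<close> of policies.
\<close>

definition correctness_rate ::
  "('q \<Rightarrow> 'a pmf) \<Rightarrow> ('q \<Rightarrow> 'a \<Rightarrow> bool pmf) \<Rightarrow> 'q \<Rightarrow> real" where
  "correctness_rate old ver q = (\<Sum>\<^sub>\<infinity>a. pmf (old q) a * pmf (ver q a) True)"

definition pos_policy ::
  "('q \<Rightarrow> 'a pmf) \<Rightarrow> ('q \<Rightarrow> 'a \<Rightarrow> bool pmf) \<Rightarrow> 'q \<Rightarrow> 'a \<Rightarrow> real" where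
  "pos_policy old ver q a =
     pmf (old q) a * pmf (ver q a) True / (\<Sum>\<^sub>\<infinity>a'. pmf (old q) a' * pmf (ver q a') True)"

definition neg_policy ::
  "('q \<Rightarrow> 'a pmf) \<Rightarrow> ('q \<Rightarrow> 'a \<Rightarrow> bool pmf) \<Rightarrow> 'q \<Rightarrow> 'a \<Rightarrow> real" where
  "neg_policy old ver q a =
     pmf (old q) a * (1 - pmf (ver q a) True) /
       (\<Sum>\<^sub>\<infinity>a'. pmf (old q) a' * (1 - pmf (ver q a') True))"

definition implicit_neg_policy ::
  "('q \<Rightarrow> 'a pmf) \<Rightarrow> ('q \<Rightarrow> 'a \<Rightarrow> bool pmf) \<Rightarrow> ('t \<Rightarrow> 'q \<Rightarrow> 'a pmf) \<Rightarrow> 't \<Rightarrow> 'q \<Rightarrow> 'a \<Rightarrow> real" where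
  "implicit_neg_policy old ver model \<theta> q a =
     (pmf (old q) a - correctness_rate old ver q * pmf (model \<theta> q) a) /
       (1 - correctness_rate old ver q)"

text \<open>
  The formula for the implicit negative policy may produce negative numbers, whose logarithm has no
  meaning. The problem is therefore posed over the parameters for which the formula does define a
  policy on the training questions. Without this constraint the result would fail: at an answer
  outside the support of the negative policy, a negative value is not seen by the objective but
  frees additional mass for the other answers.
\<close>

definition is_distribution :: "('a \<Rightarrow> real) \<Rightarrow> bool" where
  "is_distribution f \<longleftrightarrow> (\<forall>a. 0 \<le> f a) \<and> (f has_sum 1) UNIV"

definition admissible ::
  "'q pmf \<Rightarrow> ('q \<Rightarrow> 'a pmf) \<Rightarrow> ('q \<Rightarrow> 'a \<Rightarrow> bool pmf) \<Rightarrow> ('t \<Rightarrow> 'q \<Rightarrow> 'a pmf) \<Rightarrow> 't \<Rightarrow> bool" where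
  "admissible p old ver model \<theta> \<longleftrightarrow>
     (\<forall>q\<in>set_pmf p. is_distribution (implicit_neg_policy old ver model \<theta> q))"

text \<open>
  The logarithm with \<open>log 0 = -\<infinity>\<close> (\<open>ln 0 = 0\<close> on the reals). Arguments below 0 do not occur for
  admissible parameters.
\<close>

definition elog :: "real \<Rightarrow> ereal" where
  "elog x = (if 0 < x then ereal (ln x) else - \<infinity>)"

text \<open>
  The expectation of an extended-real function, as the difference of the expectations of its
  positive and its negative part. For admissible parameters the integrands below have constant sign
  almost surely, so that \<open>\<infinity> - \<infinity>\<close> does not occur.
\<close>

definition ereal_expectation :: "'b pmf \<Rightarrow> ('b \<Rightarrow> ereal) \<Rightarrow> ereal" where
  "ereal_expectation M f =
     enn2ereal (\<integral>\<^sup>+x. e2ennreal (f x) \<partial>measure_pmf M) -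
     enn2ereal (\<integral>\<^sup>+x. e2ennreal (- f x) \<partial>measure_pmf M)"

text \<open>
  The joint distribution \<open>p(q) \<pi>\<^sup>-(a|q)\<close>. The use of \<^const>\<open>embed_pmf\<close> is justified for correctness
  rates below 1 by lemma \<open>pmf_embed_neg_policy\<close> below.
\<close>

definition neg_joint ::
  "'q pmf \<Rightarrow> ('q \<Rightarrow> 'a pmf) \<Rightarrow> ('q \<Rightarrow> 'a \<Rightarrow> bool pmf) \<Rightarrow> ('q \<times> 'a) pmf" where
  "neg_joint p old ver =
     bind_pmf p (\<lambda>q. map_pmf (\<lambda>a. (q, a)) (embed_pmf (neg_policy old ver q)))"

definition log_likelihood ::
  "'q pmf \<Rightarrow> ('q \<Rightarrow> 'a pmf) \<Rightarrow> ('q \<Rightarrow> 'a \<Rightarrow> bool pmf) \<Rightarrow> ('t \<Rightarrow> 'q \<Rightarrow> 'a pmf) \<Rightarrow> 't \<Rightarrow> ereal" where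
  "log_likelihood p old ver model \<theta> =
     ereal_expectation (neg_joint p old ver)
       (\<lambda>(q, a). elog (implicit_neg_policy old ver model \<theta> q a))"

text \<open>
  With unlimited data, drawing from the dataset is drawing from its population distribution, and
  drawing from the subset of negative answers is drawing from that distribution conditioned on
  \<open>r = 0\<close>. The marginal of the latter on the questions is proportional to \<open>p(q) (1 - r\<^sub>q)\<close>, not
  equal to \<open>p(q)\<close>.
\<close>

definition dataset ::
  "'q pmf \<Rightarrow> ('q \<Rightarrow> 'a pmf) \<Rightarrow> ('q \<Rightarrow> 'a \<Rightarrow> bool pmf) \<Rightarrow> ('q \<times> 'a \<times> bool) pmf" where
  "dataset p old ver =
     bind_pmf p (\<lambda>q. bind_pmf (old q) (\<lambda>a. map_pmf (\<lambda>r. (q, a, r)) (ver q a)))"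

definition neg_dataset ::
  "'q pmf \<Rightarrow> ('q \<Rightarrow> 'a pmf) \<Rightarrow> ('q \<Rightarrow> 'a \<Rightarrow> bool pmf) \<Rightarrow> ('q \<times> 'a) pmf" where
  "neg_dataset p old ver =
     map_pmf (\<lambda>(q, a, r). (q, a)) (cond_pmf (dataset p old ver) {(q, a, r). \<not> r})"

definition neg_loss ::
  "'q pmf \<Rightarrow> ('q \<Rightarrow> 'a pmf) \<Rightarrow> ('q \<Rightarrow> 'a \<Rightarrow> bool pmf) \<Rightarrow> ('t \<Rightarrow> 'q \<Rightarrow> 'a pmf) \<Rightarrow> 't \<Rightarrow> ereal" where
  "neg_loss p old ver model \<theta> =
     - ereal_expectation (neg_dataset p old ver)
         (\<lambda>(q, a). elog ((pmf (old q) a - correctness_rate old ver q * pmf (model \<theta> q) a) /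
                         (1 - correctness_rate old ver q)))"

lemma summable_on_pmf: "pmf P summable_on UNIV"
  using integrable_pmf[of UNIV P]
  by (metis abs_summable_equivalent abs_summable_on_def abs_summable_summable)

lemma infsum_pmf: "(\<Sum>\<^sub>\<infinity>a. pmf P a) = 1"
  using infsetsum_infsum[of "pmf P" UNIV] sum_pmf_eq_1 infsetsum_pmf_eq_1[of P UNIV]
  by (simp add: abs_summable_on_def integrable_pmf)

lemma summable_on_pmf_mult:
  assumes "\<And>a. 0 \<le> g a" "\<And>a. g a \<le> 1"
  shows "(\<lambda>a. pmf P a * g a) summable_on UNIV"
  by (rule summable_on_comparison_test[OF summable_on_pmf[of P]])
    (auto intro: mult_left_le mult_nonneg_nonneg assms)

lemma infsum_incorrect:
  "(\<Sum>\<^sub>\<infinity>a. pmf (old q) a * (1 - pmf (ver q a) True)) = 1 - correctness_rate old ver q"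
proof -
  have "(\<Sum>\<^sub>\<infinity>a. pmf (old q) a * (1 - pmf (ver q a) True)) =
        (\<Sum>\<^sub>\<infinity>a. pmf (old q) a + - (pmf (old q) a * pmf (ver q a) True))"
    by (simp add: algebra_simps)
  also have "\<dots> = 1 - correctness_rate old ver q"
    by (subst infsum_add)
      (auto simp: summable_on_pmf summable_on_pmf_mult pmf_le_1 infsum_pmf infsum_uminus
         summable_on_uminus correctness_rate_def)
  finally show ?thesis .
qed

lemma pmf_embed_neg_policy:
  assumes "correctness_rate old ver q < 1"
  shows "pmf (embed_pmf (neg_policy old ver q)) a = neg_policy old ver q a"
proof (rule pmf_embed_pmf)
  have nn: "0 \<le> neg_policy old ver q x" for x
    using assms by (simp add: neg_policy_def infsum_incorrect pmf_le_1)
  then show "0 \<le> neg_policy old ver q x" for x .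
  have eq: "neg_policy old ver q = (\<lambda>x. pmf (old q) x * (1 - pmf (ver q x) True) *
      inverse (1 - correctness_rate old ver q))"
    by (rule ext) (simp only: neg_policy_def infsum_incorrect divide_inverse)
  have sm: "neg_policy old ver q summable_on UNIV"
    unfolding eq by (intro summable_on_cmult_left summable_on_pmf_mult) (auto simp: pmf_le_1)
  have "(\<Sum>\<^sub>\<infinity>x. neg_policy old ver q x) = 1"
    unfolding eq using assms by (subst infsum_cmult_left') (simp add: infsum_incorrect)
  moreover have "Infinite_Set_Sum.abs_summable_on (neg_policy old ver q) UNIV"
    using sm summable_on_iff_abs_summable_on_real abs_summable_equivalent by blast
  ultimately show "(\<integral>\<^sup>+x. ennreal (neg_policy old ver q x) \<partial>count_space UNIV) = 1"
    using nn by (simp add: nn_integral_conv_infsetsum infsetsum_infsum)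
qed

end

theory Submission
  imports Defs
begin

text \<open>
  Up to the sign, both objectives are averages \<open>E\<^sub>p [w\<^sub>q H(\<pi>\<^sup>-(\<cdot>|q), \<pi>\<^sup>-\<^sub>\<theta>(\<cdot>|q))]\<close> of cross entropies, with the
  weight \<open>w\<^sub>q = 1\<close> for the likelihood and \<open>w\<^sub>q = (1 - r\<^sub>q) / Z\<close> for the loss on the negative
  dataset. By Gibbs' inequality, an average with positive weights that is finite somewhere is
  minimal exactly where \<open>\<pi>\<^sup>-\<^sub>\<theta> = \<pi>\<^sup>-\<close> on the support of \<open>p\<close>, whatever the weights are; since
  \<open>r\<^sub>q > 0\<close>, this is the condition \<open>\<pi>\<^sup>+\<^sub>\<theta> = \<pi>\<^sup>+\<close>.
\<close>

section \<open>Cross entropy and Gibbs' inequality\<close>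

text \<open>Values in \<open>ennreal\<close> make every integral below exist. Since
  \<open>e2ennreal\<close> truncates negative values to 0, this is the negative logarithm only for
  arguments up to 1, which covers probabilities.\<close>

definition neg_log :: "real \<Rightarrow> ennreal" where
  "neg_log x = e2ennreal (- elog x)"

definition cross_entropy :: "'a pmf \<Rightarrow> 'a pmf \<Rightarrow> ennreal" where
  "cross_entropy N Q = (\<integral>\<^sup>+a. neg_log (pmf Q a) \<partial>measure_pmf N)"

lemma neg_log_pos: "0 < x \<Longrightarrow> neg_log x = ennreal (- ln x)"
  by (simp add: neg_log_def elog_def)

lemma neg_log_nonpos: "x \<le> 0 \<Longrightarrow> neg_log x = \<infinity>"
  by (simp add: neg_log_def elog_def)

lemma elog_nonpos: "x \<le> 1 \<Longrightarrow> elog x \<le> 0"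
  by (simp add: elog_def)

text \<open>
  The inequality \<open>ln (x / n) \<le> x / n - 1\<close>, rearranged so that no subtraction occurs in \<^typ>\<open>ennreal\<close>.
\<close>

lemma neg_log_tangent_strict:
  assumes "0 < n" "n \<le> 1" "0 \<le> x" "x \<le> 1" "x \<noteq> n"
  shows "neg_log n + 1 < neg_log x + ennreal (x / n)"
proof (cases "x = 0")
  case True
  then show ?thesis
    using assms by (simp add: neg_log_pos neg_log_nonpos ennreal_add_less_top)
next
  case False
  have "ln (x / n) \<noteq> x / n - 1" "ln (x / n) \<le> x / n - 1"
    using assms False ln_eq_minus_one[of "x / n"] ln_le_minus_one[of "x / n"] by auto
  then have "- ln n + 1 < - ln x + x / n"
    using assms False by (simp add: ln_div)
  moreover have "0 \<le> - ln n"
    using assms by simp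
  ultimately have "ennreal (- ln n + 1) < ennreal (- ln x + x / n)"
    by (intro ennreal_lessI) linarith+
  then show ?thesis
    using assms False by (simp add: neg_log_pos del: ennreal_1 flip: ennreal_1 ennreal_plus)
qed

lemma neg_log_tangent:
  assumes "0 < n" "n \<le> 1" "0 \<le> x" "x \<le> 1"
  shows "neg_log n + 1 \<le> neg_log x + ennreal (x / n)"
  using neg_log_tangent_strict[of n x] assms by (cases "x = n") auto

text \<open>The integral is the mass that \<open>Q\<close> puts on the support of \<open>N\<close>:
  off that support the weight \<open>pmf N a\<close> is 0. It is below 1 when \<open>Q\<close>
  charges other points.\<close>

lemma nn_integral_pmf_ratio_le:
  "(\<integral>\<^sup>+a. ennreal (pmf Q a / pmf N a) \<partial>measure_pmf N) \<le> 1"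
proof -
  have "(\<integral>\<^sup>+a. ennreal (pmf Q a / pmf N a) \<partial>measure_pmf N) =
        (\<integral>\<^sup>+a. ennreal (pmf N a) * ennreal (pmf Q a / pmf N a) \<partial>count_space UNIV)"
    by (rule nn_integral_measure_pmf)
  also have "\<dots> \<le> (\<integral>\<^sup>+a. ennreal (pmf Q a) \<partial>count_space UNIV)"
    by (intro nn_integral_mono) (auto simp flip: ennreal_mult)
  also have "\<dots> = 1"
    by (simp add: nn_integral_pmf)
  finally show ?thesis .
qed

text \<open>Integrating the tangent inequality against \<open>N\<close> adds 1 on the left and at
  most 1 on the right, and the two cancel. Strictness at one atom of \<open>N\<close> survives
  integration when the entropy \<open>cross_entropy N N\<close> is finite.\<close>

lemma
  shows gibbs_inequality: "cross_entropy N N \<le> cross_entropy N Q"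
    and gibbs_inequality_strict:
      "Q \<noteq> N \<Longrightarrow> cross_entropy N N \<noteq> \<infinity> \<Longrightarrow> cross_entropy N N < cross_entropy N Q"
proof -
  let ?l = "\<lambda>a. neg_log (pmf N a) + 1"
  let ?u = "\<lambda>a. neg_log (pmf Q a) + ennreal (pmf Q a / pmf N a)"
  have l: "(\<integral>\<^sup>+a. ?l a \<partial>measure_pmf N) = cross_entropy N N + 1"
    by (simp add: nn_integral_add cross_entropy_def)
  have u: "(\<integral>\<^sup>+a. ?u a \<partial>measure_pmf N) \<le> cross_entropy N Q + 1"
    unfolding cross_entropy_def
    by (subst nn_integral_add) (auto intro!: add_left_mono nn_integral_pmf_ratio_le)
  have le: "AE a in measure_pmf N. ?l a \<le> ?u a"
    by (auto simp: AE_measure_pmf_iff pmf_le_1 pmf_positive intro!: neg_log_tangent)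
  have "cross_entropy N N + 1 \<le> cross_entropy N Q + 1"
    using nn_integral_mono_AE[OF le] l u by (metis order.trans)
  then show "cross_entropy N N \<le> cross_entropy N Q"
    by simp
  assume "Q \<noteq> N" and fin: "cross_entropy N N \<noteq> \<infinity>"
  \<comment> \<open>Both total masses are 1, so distinct pmfs differ downwards somewhere; at such a
    point \<open>N\<close> is positive, hence it is an atom of \<open>N\<close>.\<close>
  then obtain x where x: "pmf Q x < pmf N x"
    using pmf_neq_exists_less by blast
  then have xN: "x \<in> set_pmf N"
    by (metis not_less pmf_nonneg set_pmf_iff)
  have "?l x < ?u x"
    using x xN by (intro neg_log_tangent_strict) (auto simp: pmf_le_1 pmf_positive)
  then have "\<not> (AE a in measure_pmf N. ?u a \<le> ?l a)"
    using xN by (auto simp: AE_measure_pmf_iff not_le)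
  then have "(\<integral>\<^sup>+a. ?l a \<partial>measure_pmf N) < (\<integral>\<^sup>+a. ?u a \<partial>measure_pmf N)"
    using le l fin by (intro nn_integral_less) auto
  then have "cross_entropy N N + 1 < cross_entropy N Q + 1"
    using l u by (metis order.strict_trans2)
  then show "cross_entropy N N < cross_entropy N Q"
    by (meson add_right_mono not_le)
qed

section \<open>Weighted averages over the questions\<close>

definition mean_cross_entropy ::
  "'q pmf \<Rightarrow> ('q \<Rightarrow> ennreal) \<Rightarrow> ('q \<Rightarrow> 'a pmf) \<Rightarrow> ('q \<Rightarrow> 'a pmf) \<Rightarrow> ennreal" where
  "mean_cross_entropy p w N Q = (\<integral>\<^sup>+q. w q * cross_entropy (N q) (Q q) \<partial>measure_pmf p)"

lemma mean_cross_entropy_cong: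
  assumes "\<And>q. q \<in> set_pmf p \<Longrightarrow> Q q = Q' q"
  shows "mean_cross_entropy p w N Q = mean_cross_entropy p w N Q'"
  unfolding mean_cross_entropy_def
  using assms by (intro nn_integral_cong_AE) (auto simp: AE_measure_pmf_iff)

lemma mean_cross_entropy_self_le:
  "mean_cross_entropy p w N N \<le> mean_cross_entropy p w N Q"
  unfolding mean_cross_entropy_def
  by (intro nn_integral_mono mult_left_mono gibbs_inequality) auto

text \<open>A finite average forces finite entropy at each atom of \<open>p\<close>, because the
  weights are positive. Gibbs' inequality is then strict at \<open>q\<close>, the positive finite
  weight preserves this, and a strict gap at one atom is seen by the integral.\<close>

lemma mean_cross_entropy_self_less:
  assumes w: "\<And>q. q \<in> set_pmf p \<Longrightarrow> 0 < w q \<and> w q < \<infinity>"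
    and fin: "mean_cross_entropy p w N N \<noteq> \<infinity>"
    and q: "q \<in> set_pmf p" "Q q \<noteq> N q"
  shows "mean_cross_entropy p w N N < mean_cross_entropy p w N Q"
proof -
  have "AE q in measure_pmf p. w q * cross_entropy (N q) (N q) \<noteq> \<infinity>"
    using fin unfolding mean_cross_entropy_def by (intro nn_integral_PInf_AE) auto
  then have "w q * cross_entropy (N q) (N q) \<noteq> \<infinity>"
    using q by (auto simp: AE_measure_pmf_iff)
  then have "cross_entropy (N q) (N q) \<noteq> \<infinity>"
    using w[OF q(1)] by (auto simp: ennreal_mult_eq_top_iff)
  then have "w q * cross_entropy (N q) (N q) < w q * cross_entropy (N q) (Q q)"
    using gibbs_inequality_strict[OF q(2)] w[OF q(1)] by (intro ennreal_mult_strict_left_mono) auto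
  then have "\<not> (AE q in measure_pmf p.
      w q * cross_entropy (N q) (Q q) \<le> w q * cross_entropy (N q) (N q))"
    using q by (auto simp: AE_measure_pmf_iff not_le)
  then show ?thesis
    unfolding mean_cross_entropy_def
    using fin[unfolded mean_cross_entropy_def]
    by (intro nn_integral_less) (auto intro!: mult_left_mono gibbs_inequality)
qed

section \<open>The policies as distributions\<close>

lemma pmf_embed_distribution:
  assumes "is_distribution f"
  shows "pmf (embed_pmf f) a = f a"
proof (rule pmf_embed_pmf)
  show nn: "0 \<le> f x" for x
    using assms by (simp add: is_distribution_def)
  have f: "f summable_on UNIV" "infsum f UNIV = 1"
    using assms by (auto simp: is_distribution_def has_sum_imp_summable infsumI)
  then have "Infinite_Set_Sum.abs_summable_on f UNIV"
    using summable_on_iff_abs_summable_on_real abs_summable_equivalent by blast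
  then show "(\<integral>\<^sup>+x. ennreal (f x) \<partial>count_space UNIV) = 1"
    using nn f by (simp add: nn_integral_conv_infsetsum infsetsum_infsum)
qed

lemma is_distribution_pmf: "is_distribution (pmf P)"
  by (simp add: is_distribution_def has_sum_iff summable_on_pmf infsum_pmf)

lemma is_distribution_pos_policy:
  assumes "0 < correctness_rate old ver q"
  shows "is_distribution (pos_policy old ver q)"
proof -
  have "((\<lambda>a. pmf (old q) a * pmf (ver q a) True) has_sum correctness_rate old ver q) UNIV"
    by (simp add: has_sum_iff summable_on_pmf_mult pmf_le_1 correctness_rate_def)
  then have "((\<lambda>a. pmf (old q) a * pmf (ver q a) True * inverse (correctness_rate old ver q))
      has_sum correctness_rate old ver q * inverse (correctness_rate old ver q)) UNIV"
    by (rule has_sum_cmult_left)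
  then show ?thesis
    using assms
    by (simp add: is_distribution_def pos_policy_def[abs_def] divide_inverse flip: correctness_rate_def)
qed

text \<open>By \<open>infsum_incorrect\<close> both negative policies have denominator 1 - r.
  Clearing it and cancelling \<open>pmf (old q) a\<close> leaves r times the model's probability
  against the numerator of the positive policy, and r > 0 can be divided out.\<close>

lemma implicit_neg_policy_eq_iff:
  assumes "0 < correctness_rate old ver q" "correctness_rate old ver q < 1"
  shows "implicit_neg_policy old ver model \<theta> q a = neg_policy old ver q a \<longleftrightarrow>
         pmf (model \<theta> q) a = pos_policy old ver q a"
proof -
  let ?r = "correctness_rate old ver q"
  have "implicit_neg_policy old ver model \<theta> q a = neg_policy old ver q a \<longleftrightarrow>
        pmf (old q) a - ?r * pmf (model \<theta> q) a = pmf (old q) a * (1 - pmf (ver q a) True)"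
    unfolding implicit_neg_policy_def neg_policy_def infsum_incorrect using assms by simp
  also have "\<dots> \<longleftrightarrow> pmf (model \<theta> q) a = pmf (old q) a * pmf (ver q a) True / ?r"
    using assms by (auto simp: field_simps)
  finally show ?thesis
    by (simp add: pos_policy_def correctness_rate_def)
qed

abbreviation neg_pmf ::
  "('q \<Rightarrow> 'a pmf) \<Rightarrow> ('q \<Rightarrow> 'a \<Rightarrow> bool pmf) \<Rightarrow> 'q \<Rightarrow> 'a pmf" where
  "neg_pmf old ver q \<equiv> embed_pmf (neg_policy old ver q)"

text \<open>Faithful to the formula for admissible parameters and training questions; elsewhere
  \<open>embed_pmf\<close> may be applied to a function that is not a distribution.\<close>

abbreviation implicit_neg_pmf ::
  "('q \<Rightarrow> 'a pmf) \<Rightarrow> ('q \<Rightarrow> 'a \<Rightarrow> bool pmf) \<Rightarrow> ('t \<Rightarrow> 'q \<Rightarrow> 'a pmf) \<Rightarrow> 't \<Rightarrow> 'q \<Rightarrow> 'a pmf" where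
  "implicit_neg_pmf old ver model \<theta> q \<equiv> embed_pmf (implicit_neg_policy old ver model \<theta> q)"

section \<open>Disintegration of the sampling distributions\<close>

text \<open>Here \<open>w\<close> is the density of the question marginal of \<open>D\<close>
  relative to \<open>p\<close>, and \<open>N q\<close> is the conditional distribution of the
  answers wherever \<open>w q\<close> is positive. The form by integrals can be used directly to
  rewrite expectations.\<close>

definition has_disintegration ::
  "('q \<times> 'a) pmf \<Rightarrow> 'q pmf \<Rightarrow> ('q \<Rightarrow> ennreal) \<Rightarrow> ('q \<Rightarrow> 'a pmf) \<Rightarrow> bool" where
  "has_disintegration D p w N \<longleftrightarrow>
     (\<forall>g. (\<integral>\<^sup>+x. g x \<partial>measure_pmf D) =
          (\<integral>\<^sup>+q. w q * (\<integral>\<^sup>+a. g (q, a) \<partial>measure_pmf (N q)) \<partial>measure_pmf p))"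

lemma has_disintegration_neg_joint:
  "has_disintegration (neg_joint p old ver) p (\<lambda>_. 1) (neg_pmf old ver)"
  by (simp add: has_disintegration_def neg_joint_def)

text \<open>Bayes' rule: the probability of drawing \<open>a\<close> with an incorrect label is that
  of an incorrect label times that of \<open>a\<close> under the negative policy.\<close>

lemma nn_integral_incorrect:
  assumes "correctness_rate old ver q < 1"
  shows "(\<integral>\<^sup>+a. g a * ennreal (1 - pmf (ver q a) True) \<partial>measure_pmf (old q)) =
         ennreal (1 - correctness_rate old ver q) *
           (\<integral>\<^sup>+a. g a \<partial>measure_pmf (neg_pmf old ver q))"
proof -
  have "ennreal (pmf (old q) a) * (g a * ennreal (1 - pmf (ver q a) True)) =
      ennreal (1 - correctness_rate old ver q) * (ennreal (pmf (neg_pmf old ver q) a) * g a)" for a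
  proof -
    have "pmf (old q) a * (1 - pmf (ver q a) True) =
        (1 - correctness_rate old ver q) * pmf (neg_pmf old ver q) a"
      using assms by (simp add: pmf_embed_neg_policy neg_policy_def infsum_incorrect)
    then have "ennreal (pmf (old q) a) * ennreal (1 - pmf (ver q a) True) =
        ennreal (1 - correctness_rate old ver q) * ennreal (pmf (neg_pmf old ver q) a)"
      using assms by (simp add: pmf_le_1 flip: ennreal_mult)
    then show ?thesis
      by (metis mult.assoc mult.commute)
  qed
  then show ?thesis
    by (simp add: nn_integral_measure_pmf[of "old q"] nn_integral_measure_pmf[of "neg_pmf old ver q"]
        nn_integral_cmult)
qed

text \<open>Conditioning divides by the overall probability \<open>?Z\<close> of an incorrect label,
  so \<open>c\<close> is its inverse; the factor 1 - r is what question \<open>q\<close> contributes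
  to \<open>?Z\<close>, relative to \<open>p\<close>.\<close>

lemma has_disintegration_neg_dataset:
  fixes p :: "'q pmf" and old :: "'q \<Rightarrow> 'a pmf"
  assumes rate: "\<And>q. q \<in> set_pmf p \<Longrightarrow> correctness_rate old ver q < 1"
  obtains c where "0 < c" "c < \<infinity>"
    "has_disintegration (neg_dataset p old ver) p
       (\<lambda>q. c * ennreal (1 - correctness_rate old ver q)) (neg_pmf old ver)"
proof
  let ?A = "{(q, a, r). \<not> r} :: ('q \<times> 'a \<times> bool) set"
  let ?Z = "emeasure (measure_pmf (dataset p old ver)) ?A"
  \<comment> \<open>The conditioning event must have positive probability for
    \<open>cond_pmf\<close> to be meaningful. If all answers to a training question were surely
    correct, its rate would be 1.\<close>
  have cond: "set_pmf (dataset p old ver) \<inter> ?A \<noteq> {}"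
  proof -
    obtain q where q: "q \<in> set_pmf p"
      using set_pmf_not_empty by fast
    have "\<exists>a\<in>set_pmf (old q). pmf (ver q a) True \<noteq> 1"
    proof (rule ccontr)
      assume "\<not> ?thesis"
      then have "pmf (old q) a * pmf (ver q a) True = pmf (old q) a" for a
        by (cases "a \<in> set_pmf (old q)") (auto simp: set_pmf_iff)
      then have "correctness_rate old ver q = 1"
        by (simp only: correctness_rate_def infsum_pmf)
      then show False
        using rate[OF q] by simp
    qed
    then obtain a where a: "a \<in> set_pmf (old q)" "pmf (ver q a) True \<noteq> 1"
      by blast
    then have "False \<in> set_pmf (ver q a)"
      by (simp add: set_pmf_iff pmf_False_conv_True)
    then show ?thesis
      using q a by (force simp: dataset_def)
  qed
  then have Z0: "?Z \<noteq> 0"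
    by (simp add: measure_pmf.emeasure_eq_measure measure_pmf_zero_iff)
  \<comment> \<open>Positivity of the inverse comes from \<open>?Z\<close> being finite, finiteness
    from \<open>?Z\<close> being nonzero.\<close>
  show "0 < inverse ?Z"
    by (simp add: ennreal_inverse_positive measure_pmf.emeasure_eq_measure)
  show "inverse ?Z < \<infinity>"
    using Z0 by (simp add: less_top[symmetric])
  show "has_disintegration (neg_dataset p old ver) p
      (\<lambda>q. inverse ?Z * ennreal (1 - correctness_rate old ver q)) (neg_pmf old ver)"
    unfolding has_disintegration_def
  proof
    fix g :: "'q \<times> 'a \<Rightarrow> ennreal"
    \<comment> \<open>Integrating out the label leaves the probability of
      \<open>False\<close>.\<close>
    have inner: "(\<integral>\<^sup>+r. g (q, a) * indicator ?A (q, a, r) \<partial>measure_pmf (ver q a)) =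
        g (q, a) * ennreal (1 - pmf (ver q a) True)" for q a
    proof -
      have "(\<integral>\<^sup>+r. g (q, a) * indicator ?A (q, a, r) \<partial>measure_pmf (ver q a)) =
          g (q, a) * (\<integral>\<^sup>+r. indicator {False} r \<partial>measure_pmf (ver q a))"
        by (subst nn_integral_cmult[symmetric])
          (auto intro!: nn_integral_cong simp: indicator_def)
      also have "\<dots> = g (q, a) * ennreal (1 - pmf (ver q a) True)"
        by (simp add: emeasure_pmf_single pmf_False_conv_True)
      finally show ?thesis .
    qed
    have "(\<integral>\<^sup>+x. g x \<partial>measure_pmf (neg_dataset p old ver)) =
        (\<integral>\<^sup>+x. (case x of (q, a, r) \<Rightarrow> g (q, a)) * indicator ?A x \<partial>measure_pmf (dataset p old ver)) / ?Z"
      using cond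
      by (simp add: neg_dataset_def cond_pmf.rep_eq nn_integral_uniform_measure case_prod_unfold)
    also have "(\<integral>\<^sup>+x. (case x of (q, a, r) \<Rightarrow> g (q, a)) * indicator ?A x \<partial>measure_pmf (dataset p old ver)) =
        (\<integral>\<^sup>+q. \<integral>\<^sup>+a. g (q, a) * ennreal (1 - pmf (ver q a) True) \<partial>measure_pmf (old q) \<partial>measure_pmf p)"
      by (simp add: dataset_def inner)
    also have "\<dots> = (\<integral>\<^sup>+q. ennreal (1 - correctness_rate old ver q) *
        (\<integral>\<^sup>+a. g (q, a) \<partial>measure_pmf (neg_pmf old ver q)) \<partial>measure_pmf p)"
      using rate by (intro nn_integral_cong_AE) (auto simp: AE_measure_pmf_iff intro!: nn_integral_incorrect)
    finally show "(\<integral>\<^sup>+x. g x \<partial>measure_pmf (neg_dataset p old ver)) =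
        (\<integral>\<^sup>+q. inverse ?Z * ennreal (1 - correctness_rate old ver q) *
          (\<integral>\<^sup>+a. g (q, a) \<partial>measure_pmf (neg_pmf old ver q)) \<partial>measure_pmf p)"
      by (simp add: divide_ennreal_def nn_integral_cmult mult.assoc mult.commute[of _ "inverse ?Z"])
  qed
qed

section \<open>Optimality for a general objective\<close>

text \<open>Admissibility makes the arguments of the logarithm probabilities, so the positive part
  of the integrand vanishes on the training questions, and the negative part integrates to the mean
  cross entropy.\<close>

lemma expectation_elog_implicit_neg_policy:
  assumes D: "has_disintegration D p w N"
    and adm: "admissible p old ver model \<theta>"
  shows "ereal_expectation D (\<lambda>(q, a). elog (implicit_neg_policy old ver model \<theta> q a)) =
         - enn2ereal (mean_cross_entropy p w N (implicit_neg_pmf old ver model \<theta>))"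
proof -
  have emb: "implicit_neg_policy old ver model \<theta> q a = pmf (implicit_neg_pmf old ver model \<theta> q) a"
    if "q \<in> set_pmf p" for q a
    using adm that by (simp add: admissible_def pmf_embed_distribution)
  have "(\<integral>\<^sup>+x. e2ennreal (case x of (q, a) \<Rightarrow> elog (implicit_neg_policy old ver model \<theta> q a))
      \<partial>measure_pmf D) = (\<integral>\<^sup>+q. 0 \<partial>measure_pmf p)"
    unfolding D[unfolded has_disintegration_def, rule_format]
    by (intro nn_integral_cong_AE)
      (auto simp: AE_measure_pmf_iff emb e2ennreal_neg elog_nonpos pmf_le_1)
  moreover have "(\<integral>\<^sup>+x. e2ennreal (- (case x of (q, a) \<Rightarrow> elog (implicit_neg_policy old ver model \<theta> q a)))
      \<partial>measure_pmf D) = mean_cross_entropy p w N (implicit_neg_pmf old ver model \<theta>)"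
    unfolding D[unfolded has_disintegration_def, rule_format] mean_cross_entropy_def
      cross_entropy_def neg_log_def
    by (intro nn_integral_cong_AE) (auto simp: AE_measure_pmf_iff emb)
  ultimately show ?thesis
    by (simp add: ereal_expectation_def zero_ennreal.rep_eq)
qed

lemma implicit_neg_pmf_eq_iff:
  assumes adm: "admissible p old ver model \<theta>"
    and q: "q \<in> set_pmf p"
    and rate: "0 < correctness_rate old ver q" "correctness_rate old ver q < 1"
  shows "implicit_neg_pmf old ver model \<theta> q = neg_pmf old ver q \<longleftrightarrow>
         (\<forall>a. pmf (model \<theta> q) a = pos_policy old ver q a)"
  using adm q rate
  by (simp add: pmf_eq_iff pmf_embed_neg_policy admissible_def pmf_embed_distribution
      implicit_neg_policy_eq_iff)

text \<open>The target is feasible: its implicit negative policy is the true negative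
  policy.\<close>

lemma admissible_pos_policy:
  assumes rate: "\<And>q. q \<in> set_pmf p \<Longrightarrow>
      0 < correctness_rate old ver q \<and> correctness_rate old ver q < 1"
    and \<theta>: "\<And>q a. q \<in> set_pmf p \<Longrightarrow> pmf (model \<theta> q) a = pos_policy old ver q a"
  shows "admissible p old ver model \<theta>"
  unfolding admissible_def
proof
  fix q assume q: "q \<in> set_pmf p"
  have "implicit_neg_policy old ver model \<theta> q = pmf (neg_pmf old ver q)"
    using rate[OF q] \<theta>[OF q] by (auto simp: implicit_neg_policy_eq_iff pmf_embed_neg_policy)
  then show "is_distribution (implicit_neg_policy old ver model \<theta> q)"
    by (simp add: is_distribution_pmf)
qed

text \<open>Keeping \<open>D\<close> and \<open>w\<close> general covers both objectives. On
  admissible parameters the objective is at most \<open>- ?H\<close>, the target attains this bound,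
  and any deviation on a training question falls strictly below it.\<close>

lemma is_arg_max_expectation_iff:
  assumes rate: "\<And>q. q \<in> set_pmf p \<Longrightarrow>
      0 < correctness_rate old ver q \<and> correctness_rate old ver q < 1"
    and capacity: "surj model"
    and D: "has_disintegration D p w (neg_pmf old ver)"
    and w: "\<And>q. q \<in> set_pmf p \<Longrightarrow> 0 < w q \<and> w q < \<infinity>"
    and fin: "admissible p old ver model \<theta>0"
      "mean_cross_entropy p w (neg_pmf old ver) (implicit_neg_pmf old ver model \<theta>0) \<noteq> \<infinity>"
  shows "is_arg_max
           (\<lambda>\<theta>. ereal_expectation D (\<lambda>(q, a). elog (implicit_neg_policy old ver model \<theta> q a)))
           (admissible p old ver model) \<theta> \<longleftrightarrow>
         (\<forall>q\<in>set_pmf p. \<forall>a. pmf (model \<theta> q) a = pos_policy old ver q a)"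
    (is "is_arg_max ?F ?adm \<theta> \<longleftrightarrow> ?opt \<theta>")
proof -
  let ?N = "neg_pmf old ver"
  let ?C = "\<lambda>\<theta>. mean_cross_entropy p w ?N (implicit_neg_pmf old ver model \<theta>)"
  let ?H = "mean_cross_entropy p w ?N ?N"
  have F: "?F \<theta> = - enn2ereal (?C \<theta>)" if "?adm \<theta>" for \<theta>
    using expectation_elog_implicit_neg_policy[OF D that] .
  \<comment> \<open>The entropy is bounded by the finite cross entropy at
    \<open>\<theta>0\<close>.\<close>
  have H: "?H \<noteq> \<infinity>"
    using fin(2) mean_cross_entropy_self_le[of p w ?N "implicit_neg_pmf old ver model \<theta>0"]
    by (auto simp: top_unique)
  have opt: "?C \<theta> = ?H \<and> ?adm \<theta>" if "?opt \<theta>" for \<theta>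
  proof -
    have adm: "?adm \<theta>"
      using that rate by (intro admissible_pos_policy) auto
    then have "?C \<theta> = ?H"
      using that rate by (intro mean_cross_entropy_cong) (simp add: implicit_neg_pmf_eq_iff)
    with adm show ?thesis by simp
  qed
  \<comment> \<open>Unlimited capacity enters here: some parameter realizes the positive policy, so
    the bound is attained.\<close>
  obtain \<theta>1 where "model \<theta>1 = (\<lambda>q. embed_pmf (pos_policy old ver q))"
    using capacity by (metis surjD)
  then have \<theta>1: "?opt \<theta>1"
    using rate by (simp add: pmf_embed_distribution is_distribution_pos_policy)
  show ?thesis
  proof
    assume max: "is_arg_max ?F ?adm \<theta>"
    then have adm: "?adm \<theta>"
      by (simp add: is_arg_max_def)
    have "\<not> ?F \<theta> < ?F \<theta>1"
      using max opt[OF \<theta>1] by (auto simp: is_arg_max_def)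
    then have "\<not> ?H < ?C \<theta>"
      using F[OF adm] F[of \<theta>1] opt[OF \<theta>1] by (simp add: less_ennreal.rep_eq)
    then show "?opt \<theta>"
      using mean_cross_entropy_self_less[OF w H] adm rate by (metis implicit_neg_pmf_eq_iff)
  next
    assume \<theta>: "?opt \<theta>"
    have "?F \<theta>' \<le> ?F \<theta>" if "?adm \<theta>'" for \<theta>'
      using F[OF that] F[of \<theta>] opt[OF \<theta>] mean_cross_entropy_self_le
      by (simp add: less_eq_ennreal.rep_eq[symmetric])
    then show "is_arg_max ?F ?adm \<theta>"
      using opt[OF \<theta>] by (auto simp: is_arg_max_def not_less)
  qed
qed

section \<open>Both objectives have the same optimizers\<close>

theorem theorem3p1:
  fixes p :: "'q pmf"
    and old :: "'q \<Rightarrow> 'a pmf"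
    and ver :: "'q \<Rightarrow> 'a \<Rightarrow> bool pmf"
    and model :: "'t \<Rightarrow> 'q \<Rightarrow> 'a pmf"
  assumes rate: "\<And>q. q \<in> set_pmf p \<Longrightarrow>
      0 < correctness_rate old ver q \<and> correctness_rate old ver q < 1"
    and capacity: "surj model"
    and proper: "\<exists>\<theta>. admissible p old ver model \<theta> \<and> log_likelihood p old ver model \<theta> \<noteq> - \<infinity>"
  shows "(\<forall>\<theta>. is_arg_max (log_likelihood p old ver model) (admissible p old ver model) \<theta> \<longleftrightarrow>
             is_arg_min (neg_loss p old ver model) (admissible p old ver model) \<theta>) \<and>
         (\<forall>\<theta>. is_arg_max (log_likelihood p old ver model) (admissible p old ver model) \<theta> \<longrightarrow>
             (\<forall>q\<in>set_pmf p. \<forall>a. pmf (model \<theta> q) a = pos_policy old ver q a))"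
proof -
  let ?opt = "\<lambda>\<theta>. \<forall>q\<in>set_pmf p. \<forall>a. pmf (model \<theta> q) a = pos_policy old ver q a"
  let ?C = "\<lambda>w \<theta>. mean_cross_entropy p w (neg_pmf old ver) (implicit_neg_pmf old ver model \<theta>)"
  obtain c where c: "0 < c" "c < \<infinity>" and D: "has_disintegration (neg_dataset p old ver) p
      (\<lambda>q. c * ennreal (1 - correctness_rate old ver q)) (neg_pmf old ver)"
    using has_disintegration_neg_dataset[of p old ver] rate by blast
  let ?w = "\<lambda>q. c * ennreal (1 - correctness_rate old ver q)"
  obtain \<theta>0 where \<theta>0: "admissible p old ver model \<theta>0" "log_likelihood p old ver model \<theta>0 \<noteq> - \<infinity>"
    using proper by blast
  \<comment> \<open>The likelihood is minus the mean cross entropy of weight 1.\<close>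
  have fin: "?C (\<lambda>_. 1) \<theta>0 \<noteq> \<infinity>"
    using \<theta>0(2) unfolding log_likelihood_def
      expectation_elog_implicit_neg_policy[OF has_disintegration_neg_joint \<theta>0(1)]
    by auto
  \<comment> \<open>Assumption \<open>proper\<close> bounds only the likelihood; as the weights of
    the loss are at most \<open>c\<close>, finiteness carries over to the loss.\<close>
  have w_le: "?w q \<le> c" if "q \<in> set_pmf p" for q
    using rate[OF that] mult_left_mono[of "ennreal (1 - correctness_rate old ver q)" 1 c] by simp
  have "?C ?w \<theta>0 \<le> (\<integral>\<^sup>+q. c * (1 * cross_entropy (neg_pmf old ver q)
      (implicit_neg_pmf old ver model \<theta>0 q)) \<partial>measure_pmf p)"
    unfolding mean_cross_entropy_def using w_le
    by (intro nn_integral_mono_AE) (auto simp: AE_measure_pmf_iff intro!: mult_right_mono)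
  also have "\<dots> = c * ?C (\<lambda>_. 1) \<theta>0"
    unfolding mean_cross_entropy_def by (rule nn_integral_cmult) simp
  also have "\<dots> < \<infinity>"
    using c fin by (simp add: ennreal_mult_less_top less_top)
  finally have fin': "?C ?w \<theta>0 \<noteq> \<infinity>"
    by simp
  have w: "0 < ?w q \<and> ?w q < \<infinity>" if "q \<in> set_pmf p" for q
    using rate[OF that] c by (simp add: ennreal_zero_less_mult_iff ennreal_mult_less_top)
  have "is_arg_max (log_likelihood p old ver model) (admissible p old ver model) \<theta> \<longleftrightarrow> ?opt \<theta>" for \<theta>
    unfolding log_likelihood_def
    by (rule is_arg_max_expectation_iff[OF rate capacity has_disintegration_neg_joint _ \<theta>0(1) fin])
      auto
  \<comment> \<open>Minimizing the loss is maximizing its negation, an expectation over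
    \<open>neg_dataset\<close>. Both problems thus reduce to the same condition \<open>?opt\<close>,
    which also gives their equivalence.\<close>
  moreover have "is_arg_min (neg_loss p old ver model) (admissible p old ver model) \<theta> \<longleftrightarrow> ?opt \<theta>" for \<theta>
    using is_arg_max_expectation_iff[OF rate capacity D w \<theta>0(1) fin', of \<theta>]
    by (simp add: is_arg_min_def is_arg_max_def neg_loss_def implicit_neg_policy_def)
  ultimately show ?thesis
    by blast
qed

end
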